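(* Assume condition $R$ (reduction of lotteries). Then the preference relation $\succsim$ over $\Pi^\infty(X)$ satisfies the four axioms ($C_1$) $\succsim$ is reflexive and transitive; ($C_2$) for all $\alpha=\langle\alpha_1,\alpha_2\rangle,\beta=\langle\beta_1,\beta_2\rangle\in P_2$: $\alpha\geq_2\beta \Leftrightarrow [\alpha_1/\overline{x},\alpha_2/\underline{x}]\succsim[\beta_1/\overline{x},\beta_2/\underline{x}]$; ($C_3$) for every $k\ge 1$, all lotteries $\pi_i,\pi_i'\in\Pi^\infty(X)$ with $\pi_i\sim\pi_i'$ ($i=1,\dots,k$) and all $\lambda_1,\dots,\lambda_k\in P$ with $\bigoplus_{i=1}^k\lambda_i=1_P$: $[\lambda_1/\pi_1,\dots,\lambda_k/\pi_k]\sim[\lambda_1/\pi_1',\dots,\lambda_k/\pi_k']$; ($C_4$) for every $x\in X$ there exists $\alpha\in P_2$ such that $x\sim[\alpha_1/\overline{x},\alpha_2/\underline{x}]$; if and only if there exists a basic utility assignment $u:X\to P_2$ such that for all $\pi,\pi'\in\Pi^\infty(X)$, $$\pi\succsim\pi' \iff AEU(\pi)\geq_2 AEU(\pi').$$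
   Context: Semiring scale. $(P,\oplus,\otimes,0_P,1_P)$ is a semiring: $(P,\oplus,0_P)$ is a commutative semigroup with neutral element $0_P$; $(P,\otimes,1_P)$ is a (not necessarily commutative) semigroup with neutral element $1_P$, for which $0_P$ is absorbing ($a\otimes 0_P=0_P\otimes a=0_P$); and $\otimes$ distributes over $\oplus$ on both sides. $P$ carries a (possibly partial) order $\geq$ such that for all $\lambda,\mu\in P$, $\lambda\geq\mu$ implies that there is $\mu'\in P$ with $\lambda=\mu\oplus\mu'$. Binary scale. $P_2=\{\langle\lambda,\mu\rangle\in P\times P:\lambda\oplus\mu=1_P\}$; elements are written $\alpha=\langle\alpha_1,\alpha_2\rangle$. It is ordered by $\langle\lambda,\mu\rangle\geq_2\langle\lambda',\mu'\rangle \Leftrightarrow (\lambda\geq\lambda'\text{ and }\mu'\geq\mu)$. The operations are extended by $\langle\lambda,\mu\rangle\oplus\langle\lambda',\mu'\rangle=\langle\lambda\oplus\lambda',\mu\oplus\mu'\rangle$ and, for $\lambda'\in P$, $\lambda'\otimes\langle\lambda,\mu\rangle=\langle\lambda'\otimes\lambda,\lambda'\otimes\mu\rangle$. Lotteries. $X=\{x_1,\dots,x_n\}$ is a finite set of consequences. A simple lottery is a function $\pi:X\to P$ with $\bigoplus_{x\in X}\pi(x)=1_P$; $\Pi(X)$ is the set of simple lotteries. Compound lotteries are lotteries over lotteries: $\Pi^1(X)=\Pi(X)$, $\Pi^k(X)=\Pi^{k-1}(\Pi(X))$ for $k>1$, and $\Pi^\infty(X)=\bigcup_{k\ge1}\Pi^k(X)$.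 A compound lottery with $k$ outcomes is written $[\lambda_1/\pi_1,\dots,\lambda_k/\pi_k]$ with $\lambda_i\in P$, $\bigoplus_{i=1}^k\lambda_i=1_P$, $\pi_i\in\Pi^\infty(X)$. A consequence $x\in X$ also denotes the degenerate simple lottery with value $1_P$ at $x$ and $0_P$ elsewhere. Condition $R$ (reduction of lotteries): every compound lottery is identified with the simple lottery given by $[\lambda_1/\pi_1,\dots,\lambda_m/\pi_m](x)=\bigoplus_{i=1}^m\lambda_i\otimes\pi_i(x)$ for all $x\in X$. Under $R$, $\Pi^\infty(X)=\Pi(X)$. Preferences. $\succsim$ is a binary relation on lotteries ("at least as good as"), with symmetric part $\sim$ and asymmetric part $\succ$. $X$ contains a best consequence $\overline{x}$ and a worst consequence $\underline{x}$, i.e. $\overline{x}\succsim x\succsim\underline{x}$ for all $x\in X$. Algebraic expected utility. A basic utility assignment is a function $u:X\to P_2$. Given $u$, for $\pi\in\Pi(X)$ (equivalently, under $R$, any $\pi\in\Pi^\infty(X)$), $AEU(\pi)=\bigoplus_{x\in X}\pi(x)\otimes u(x)$, which is an element of $P_2$.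
   Formalization: The basic utility assignment is also required to give the best consequence the value ⟨1,0⟩ and the worst the value ⟨0,1⟩; without this the "if" direction fails (over the natural numbers a constant u makes all lotteries indifferent, which violates C2). *)

theory Defs
  imports Main "HOL-Library.Product_Plus"
begin

text \<open>
  The sort of \<open>semiring_0\<close> and \<open>monoid_mult\<close> is a semiring with both neutral elements in which
  multiplication need not be commutative and \<open>0 \<noteq> 1\<close> is not required (unlike \<open>semiring_1\<close>).
  The order is not assumed to be compatible with the operations.
\<close>

class semiring_scale = semiring_0 + monoid_mult + order +
  assumes ge_imp_add: "a \<ge> b \<Longrightarrow> \<exists>c. a = b + c"

definition binary_scale :: "('p::semiring_scale \<times> 'p) set" where
  "binary_scale = {\<alpha>. fst \<alpha> + snd \<alpha> = 1}"

definition ge2 :: "'p::semiring_scale \<times> 'p \<Rightarrow> 'p \<times> 'p \<Rightarrow> bool" (infix "\<ge>\<^sub>2" 50) where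
  "\<alpha> \<ge>\<^sub>2 \<beta> \<longleftrightarrow> fst \<alpha> \<ge> fst \<beta> \<and> snd \<beta> \<ge> snd \<alpha>"

text \<open>Addition of pairs is the componentwise one of \<^theory>\<open>HOL-Library.Product_Plus\<close>.\<close>

definition scale2 :: "'p::semiring_scale \<Rightarrow> 'p \<times> 'p \<Rightarrow> 'p \<times> 'p" (infixr "\<otimes>\<^sub>2" 70) where
  "l \<otimes>\<^sub>2 \<alpha> = (l * fst \<alpha>, l * snd \<alpha>)"

text \<open>
  The finite set of consequences is the finite type \<open>'x\<close>. In \<open>Compound [(l\<^sub>1, L\<^sub>1), \<dots>, (l\<^sub>k, L\<^sub>k)]\<close>
  the lottery \<open>L\<^sub>i\<close> is received with weight \<open>l\<^sub>i\<close>; the \<open>L\<^sub>i\<close> may have different nesting depths.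
\<close>

datatype ('x, 'p) lottery =
    Simple "'x \<Rightarrow> 'p"
  | Compound "('p \<times> ('x, 'p) lottery) list"

inductive_set lotteries :: "('x::finite, 'p::semiring_scale) lottery set" where
  simple: "(\<Sum>x\<in>UNIV. \<pi> x) = 1 \<Longrightarrow> Simple \<pi> \<in> lotteries"
| compound: "ls \<noteq> [] \<Longrightarrow> (\<Sum>(l, L)\<leftarrow>ls. l) = 1 \<Longrightarrow> (\<forall>(l, L)\<in>set ls. L \<in> lotteries)
    \<Longrightarrow> Compound ls \<in> lotteries"

definition degenerate :: "'x::finite \<Rightarrow> ('x, 'p::semiring_scale) lottery" where
  "degenerate x = Simple (\<lambda>y. if y = x then 1 else 0)"

definition binary_lottery ::
    "'x::finite \<Rightarrow> 'x \<Rightarrow> 'p::semiring_scale \<times> 'p \<Rightarrow> ('x, 'p) lottery" where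
  "binary_lottery b w \<alpha> = Compound [(fst \<alpha>, degenerate b), (snd \<alpha>, degenerate w)]"

fun reduce :: "('x::finite, 'p::semiring_scale) lottery \<Rightarrow> 'x \<Rightarrow> 'p" where
  "reduce (Simple \<pi>) x = \<pi> x"
| "reduce (Compound ls) x = (\<Sum>(l, L)\<leftarrow>ls. l * reduce L x)"

text \<open>
  Condition R: the preference relation does not distinguish a lottery from the simple lottery it
  reduces to. Preference relations are only constrained on \<open>lotteries\<close>.
\<close>

definition reduction_of_lotteries ::
    "(('x::finite, 'p::semiring_scale) lottery \<Rightarrow> ('x, 'p) lottery \<Rightarrow> bool) \<Rightarrow> bool" where
  "reduction_of_lotteries pref \<longleftrightarrow>
    (\<forall>L\<in>lotteries. \<forall>L'\<in>lotteries. pref L L' \<longleftrightarrow> pref (Simple (reduce L)) (Simple (reduce L')))"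

definition indiff :: "('l \<Rightarrow> 'l \<Rightarrow> bool) \<Rightarrow> 'l \<Rightarrow> 'l \<Rightarrow> bool" where
  "indiff pref L L' \<longleftrightarrow> pref L L' \<and> pref L' L"

definition C1 ::
    "(('x::finite, 'p::semiring_scale) lottery \<Rightarrow> ('x, 'p) lottery \<Rightarrow> bool) \<Rightarrow> bool" where
  "C1 pref \<longleftrightarrow> reflp_on lotteries pref \<and> transp_on lotteries pref"

definition C2 ::
    "'x \<Rightarrow> 'x \<Rightarrow> (('x::finite, 'p::semiring_scale) lottery \<Rightarrow> ('x, 'p) lottery \<Rightarrow> bool) \<Rightarrow> bool" where
  "C2 b w pref \<longleftrightarrow> (\<forall>\<alpha>\<in>binary_scale. \<forall>\<beta>\<in>binary_scale.
     \<alpha> \<ge>\<^sub>2 \<beta> \<longleftrightarrow> pref (binary_lottery b w \<alpha>) (binary_lottery b w \<beta>))"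

definition C3 ::
    "(('x::finite, 'p::semiring_scale) lottery \<Rightarrow> ('x, 'p) lottery \<Rightarrow> bool) \<Rightarrow> bool" where
  "C3 pref \<longleftrightarrow> (\<forall>k\<ge>1. \<forall>L L' l.
     (\<forall>i<k. L i \<in> lotteries \<and> L' i \<in> lotteries \<and> indiff pref (L i) (L' i)) \<longrightarrow>
     (\<Sum>i<k. l i) = 1 \<longrightarrow>
     indiff pref (Compound (map (\<lambda>i. (l i, L i)) [0..<k])) (Compound (map (\<lambda>i. (l i, L' i)) [0..<k])))"

definition C4 ::
    "'x \<Rightarrow> 'x \<Rightarrow> (('x::finite, 'p::semiring_scale) lottery \<Rightarrow> ('x, 'p) lottery \<Rightarrow> bool) \<Rightarrow> bool" where
  "C4 b w pref \<longleftrightarrow> (\<forall>x. \<exists>\<alpha>\<in>binary_scale. indiff pref (degenerate x) (binary_lottery b w \<alpha>))"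

text \<open>
  The normalisation (best consequence \<open>(1, 0)\<close>, worst consequence \<open>(0, 1)\<close>) is not part of this
  definition. Without it a representing \<open>u\<close> need not force \<open>C2\<close>: over \<open>nat\<close>, a constant \<open>u\<close>
  represents the preference that is indifferent between all lotteries.
\<close>

definition basic_utility_assignment :: "('x::finite \<Rightarrow> 'p::semiring_scale \<times> 'p) \<Rightarrow> bool" where
  "basic_utility_assignment u \<longleftrightarrow> (\<forall>x. u x \<in> binary_scale)"

definition AEU ::
    "('x::finite \<Rightarrow> 'p::semiring_scale \<times> 'p) \<Rightarrow> ('x, 'p) lottery \<Rightarrow> 'p \<times> 'p" where
  "AEU u L = (\<Sum>x\<in>UNIV. reduce L x \<otimes>\<^sub>2 u x)"

end

theory Submission imports Defs begin

text \<open>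
  Given the axioms, let \<open>u x\<close> be a binary scale value with \<open>x\<close> indifferent to the binary lottery on
  \<open>u x\<close> (\<open>C4\<close>). A lottery reduces to the same simple lottery as the compound of degenerate lotteries;
  by \<open>C3\<close> each of these may be replaced by its binary lottery, and the result reduces to the binary
  lottery on the expected utility, so \<open>C2\<close> compares lotteries by expected utility. The normalisation
  holds because \<open>C2\<close> and antisymmetry make the choice of \<open>u x\<close> unique. Conversely, expected utility
  is affine under compounding, from which the axioms are immediate.
\<close>

lemma ge2_refl: "\<alpha> \<ge>\<^sub>2 \<alpha>"
  by (simp add: ge2_def)

lemma ge2_trans: "\<alpha> \<ge>\<^sub>2 \<beta> \<Longrightarrow> \<beta> \<ge>\<^sub>2 \<gamma> \<Longrightarrow> \<alpha> \<ge>\<^sub>2 \<gamma>"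
  by (auto simp: ge2_def intro: order_trans)

lemma ge2_antisym: "\<alpha> \<ge>\<^sub>2 \<beta> \<Longrightarrow> \<beta> \<ge>\<^sub>2 \<alpha> \<Longrightarrow> \<alpha> = \<beta>"
  by (auto simp: ge2_def prod_eq_iff)

lemma fst_AEU: "fst (AEU u L) = (\<Sum>x\<in>UNIV. reduce L x * fst (u x))"
  by (simp add: AEU_def fst_sum scale2_def)

lemma snd_AEU: "snd (AEU u L) = (\<Sum>x\<in>UNIV. reduce L x * snd (u x))"
  by (simp add: AEU_def snd_sum scale2_def)

text \<open>Right distributivity and associativity let the outer weights factor out on the left. The
  arbitrary \<open>f\<close> covers both components of \<open>u\<close> and, with \<open>f\<close>
  constantly 1, the total weight.\<close>

lemma sum_reduce_Compound:
  "(\<Sum>x\<in>UNIV. reduce (Compound ls) x * f x) = (\<Sum>(l, L)\<leftarrow>ls. l * (\<Sum>x\<in>UNIV. reduce L x * f x))"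
  by (induction ls) (auto simp: distrib_right sum.distrib sum_distrib_left mult.assoc)

lemma AEU_Compound: "AEU u (Compound ls) = (\<Sum>(l, L)\<leftarrow>ls. l \<otimes>\<^sub>2 AEU u L)"
proof -
  \<comment> \<open>Splits the sum of pairs so that the previous scalar identity applies to each
    component.\<close>
  have "(\<Sum>(l, L)\<leftarrow>ls. l \<otimes>\<^sub>2 AEU u L) =
    (\<Sum>(l, L)\<leftarrow>ls. l * fst (AEU u L), \<Sum>(l, L)\<leftarrow>ls. l * snd (AEU u L))"
    by (induction ls) (auto simp: scale2_def zero_prod_def)
  then show ?thesis
    unfolding fst_AEU snd_AEU
    by (simp only: prod_eq_iff fst_AEU snd_AEU sum_reduce_Compound fst_conv snd_conv)
qed

lemma reduce_degenerate: "reduce (degenerate y) x = (if x = y then 1 else 0)"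
  by (simp add: degenerate_def)

lemma AEU_degenerate: "AEU u (degenerate x) = u x"
  by (simp add: prod_eq_iff fst_AEU snd_AEU reduce_degenerate if_distribR if_distrib[of "\<lambda>a. a * _"]
      cong: if_cong)

text \<open>This is where the normalisation enters: it makes expected utility undo the passage from
  a scale value to its binary lottery.\<close>

lemma AEU_binary_lottery:
  "u b = (1, 0) \<Longrightarrow> u w = (0, 1) \<Longrightarrow> AEU u (binary_lottery b w \<alpha>) = \<alpha>"
  by (simp add: binary_lottery_def AEU_Compound AEU_degenerate scale2_def)

lemma reduce_binary_lottery:
  "reduce (binary_lottery b w \<alpha>) x =
    fst \<alpha> * reduce (degenerate b) x + snd \<alpha> * reduce (degenerate w) x"
  by (simp add: binary_lottery_def)

lemma degenerate_in_lotteries: "degenerate x \<in> lotteries"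
  unfolding degenerate_def by (rule lotteries.simple) simp

lemma binary_lottery_in_lotteries: "\<alpha> \<in> binary_scale \<Longrightarrow> binary_lottery b w \<alpha> \<in> lotteries"
  unfolding binary_lottery_def
  by (rule lotteries.compound) (auto simp: binary_scale_def degenerate_in_lotteries)

text \<open>By induction the inner weights add up to 1, so only the outer weights remain.\<close>

lemma sum_reduce: "L \<in> lotteries \<Longrightarrow> (\<Sum>x\<in>UNIV. reduce L x) = 1"
proof (induction rule: lotteries.induct)
  case (simple \<pi>)
  then show ?case by simp
next
  case (compound ls)
  have "(\<Sum>x\<in>UNIV. reduce (Compound ls) x) = (\<Sum>(l, L)\<leftarrow>ls. l * (\<Sum>x\<in>UNIV. reduce L x))"
    using sum_reduce_Compound[of ls "\<lambda>_. 1"] by simp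
  also have "\<dots> = (\<Sum>(l, L)\<leftarrow>ls. l)"
    using compound.IH by (intro arg_cong[of _ _ sum_list] map_cong) auto
  finally show ?case
    using compound.hyps by simp
qed

text \<open>The components of each \<open>u x\<close> add up to 1, so those of the expected utility
  add up to the total weight of \<open>L\<close>. This makes \<open>AEU u L\<close> an admissible
  value for \<open>C2\<close>.\<close>

lemma AEU_in_binary_scale:
  assumes "basic_utility_assignment u" "L \<in> lotteries"
  shows "AEU u L \<in> binary_scale"
proof -
  have "fst (AEU u L) + snd (AEU u L) = (\<Sum>x\<in>UNIV. reduce L x * (fst (u x) + snd (u x)))"
    by (simp add: fst_AEU snd_AEU distrib_left sum.distrib)
  also have "\<dots> = 1"
    using assms by (simp add: basic_utility_assignment_def binary_scale_def sum_reduce)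
  finally show ?thesis
    by (simp add: binary_scale_def)
qed

text \<open>Condition R turns both comparisons of \<open>L\<close> with \<open>L'\<close> into the
  comparison of one simple lottery with itself, which R equates with
  \<open>pref L L\<close>.\<close>

lemma indiff_if_reduce_eq:
  assumes "reduction_of_lotteries pref" "C1 pref" "L \<in> lotteries" "L' \<in> lotteries"
    and "reduce L = reduce L'"
  shows "indiff pref L L'"
  using assms unfolding reduction_of_lotteries_def C1_def indiff_def reflp_on_def by metis

lemma indiff_trans:
  assumes "C1 pref" "L \<in> lotteries" "M \<in> lotteries" "N \<in> lotteries"
    and "indiff pref L M" "indiff pref M N"
  shows "indiff pref L N"
  using assms unfolding C1_def indiff_def by (meson transp_onD)

lemma pref_cong_indiff:
  assumes "C1 pref" "L \<in> lotteries" "M \<in> lotteries" "L' \<in> lotteries" "M' \<in> lotteries"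
    and "indiff pref L M" "indiff pref L' M'"
  shows "pref L L' \<longleftrightarrow> pref M M'"
  using assms unfolding C1_def indiff_def by (meson transp_onD)

text \<open>Transfers \<open>C3\<close> from index ranges to arbitrary nonempty lists, so that it
  can be applied along an enumeration of the consequences.\<close>

lemma C3_listD:
  fixes L L' :: "'a \<Rightarrow> ('x::finite, 'p::semiring_scale) lottery"
  assumes "C3 pref" "xs \<noteq> []" "(\<Sum>x\<leftarrow>xs. l x) = 1"
    and "\<And>x. x \<in> set xs \<Longrightarrow> L x \<in> lotteries \<and> L' x \<in> lotteries \<and> indiff pref (L x) (L' x)"
  shows "indiff pref (Compound (map (\<lambda>x. (l x, L x)) xs)) (Compound (map (\<lambda>x. (l x, L' x)) xs))"
proof -
  have "(\<Sum>i<length xs. l (xs ! i)) = 1"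
    using assms(3) by (simp add: sum_list_sum_nth atLeast0LessThan)
  moreover have "length xs \<ge> 1"
    using assms(2) by (cases xs) auto
  moreover have "\<forall>i<length xs. L (xs ! i) \<in> lotteries \<and> L' (xs ! i) \<in> lotteries \<and>
      indiff pref (L (xs ! i)) (L' (xs ! i))"
    using assms(4) by simp
  ultimately have "indiff pref (Compound (map (\<lambda>i. (l (xs ! i), L (xs ! i))) [0..<length xs]))
      (Compound (map (\<lambda>i. (l (xs ! i), L' (xs ! i))) [0..<length xs]))"
    using assms(1)[unfolded C3_def, rule_format, of "length xs" "\<lambda>i. L (xs ! i)" "\<lambda>i. L' (xs ! i)"
        "\<lambda>i. l (xs ! i)"] by blast
  moreover have "map (\<lambda>i. (l (xs ! i), M (xs ! i))) [0..<length xs] = map (\<lambda>x. (l x, M x)) xs"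
    for M :: "'a \<Rightarrow> ('x, 'p) lottery"
    by (rule nth_equalityI) auto
  ultimately show ?thesis
    by (simp only:)
qed

lemma indiff_binary_lottery_AEU:
  assumes R: "reduction_of_lotteries pref" and "C1 pref" "C3 pref"
    and u: "basic_utility_assignment u"
    and ind: "\<And>x. indiff pref (degenerate x) (binary_lottery b w (u x))"
    and L: "L \<in> lotteries"
  shows "indiff pref L (binary_lottery b w (AEU u L))"
proof -
  \<comment> \<open>An enumeration without repetition: list sums in compound lotteries become sums
    over all consequences.\<close>
  obtain xs :: "'a list" where xs: "set xs = UNIV" "distinct xs"
    using finite_distinct_list[of "UNIV :: 'a set"] by auto
  have sum_xs: "(\<Sum>x\<leftarrow>xs. f x) = (\<Sum>x\<in>UNIV. f x)" for f :: "'a \<Rightarrow> 'b"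
    using sum.distinct_set_conv_list[OF xs(2), of f] xs(1) by simp
  have "xs \<noteq> []"
    using xs(1) by auto
  let ?D = "Compound (map (\<lambda>x. (reduce L x, degenerate x)) xs)"
  let ?B = "Compound (map (\<lambda>x. (reduce L x, binary_lottery b w (u x))) xs)"
  have bin: "binary_lottery b w (u x) \<in> lotteries" for x
    using u by (simp add: binary_lottery_in_lotteries basic_utility_assignment_def)
  have one: "(\<Sum>x\<leftarrow>xs. reduce L x) = 1"
    using sum_reduce[OF L] by (simp add: sum_xs)
  have D: "?D \<in> lotteries" and B: "?B \<in> lotteries"
    using \<open>xs \<noteq> []\<close> one bin degenerate_in_lotteries
    by (auto intro!: lotteries.compound simp: comp_def)
  have A: "binary_lottery b w (AEU u L) \<in> lotteries"
    by (simp add: AEU_in_binary_scale[OF u L] binary_lottery_in_lotteries)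
  have "reduce L = reduce ?D"
    by (rule ext) (simp add: comp_def sum_xs reduce_degenerate if_distrib cong: if_cong)
  then have "indiff pref L ?D"
    by (intro indiff_if_reduce_eq R \<open>C1 pref\<close> L D)
  moreover have "indiff pref ?D ?B"
    using bin ind by (intro C3_listD \<open>C3 pref\<close> \<open>xs \<noteq> []\<close> one) (auto simp: degenerate_in_lotteries)
  \<comment> \<open>Both sides are combinations of the degenerate lotteries \<open>b\<close> and
    \<open>w\<close>; collecting the coefficients of each gives the two components of
    \<open>AEU u L\<close>.\<close>
  moreover have "reduce ?B = reduce (binary_lottery b w (AEU u L))"
    by (rule ext) (simp add: comp_def sum_xs reduce_binary_lottery fst_AEU snd_AEU distrib_left
        sum.distrib sum_distrib_right mult.assoc del: reduce.simps(1))
  then have "indiff pref ?B (binary_lottery b w (AEU u L))"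
    by (intro indiff_if_reduce_eq R \<open>C1 pref\<close> B A)
  ultimately show ?thesis
    using indiff_trans[OF \<open>C1 pref\<close> L D B] indiff_trans[OF \<open>C1 pref\<close> L B A] by blast
qed

lemma AEU_represents:
  assumes R: "reduction_of_lotteries pref"
    and C1: "C1 pref" and C2: "C2 b w pref" and C3: "C3 pref" and C4: "C4 b w pref"
  shows "\<exists>u. basic_utility_assignment u \<and> u b = (1, 0) \<and> u w = (0, 1) \<and>
    (\<forall>L\<in>lotteries. \<forall>L'\<in>lotteries. pref L L' \<longleftrightarrow> AEU u L \<ge>\<^sub>2 AEU u L')"
proof -
  obtain u where u: "\<And>x. u x \<in> binary_scale"
    and ind: "\<And>x. indiff pref (degenerate x) (binary_lottery b w (u x))"
    using C4 unfolding C4_def by metis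
  have bua: "basic_utility_assignment u"
    using u by (simp add: basic_utility_assignment_def)
  have unique: "u x = \<alpha>"
    if \<alpha>: "\<alpha> \<in> binary_scale" and red: "reduce (binary_lottery b w \<alpha>) = reduce (degenerate x)"
    for x \<alpha>
  proof -
    note mem = binary_lottery_in_lotteries[OF u] binary_lottery_in_lotteries[OF \<alpha>]
      degenerate_in_lotteries
    \<comment> \<open>Both binary lotteries are indifferent to \<open>x\<close>: the first by
      reduction, the second by the choice of \<open>u\<close>.\<close>
    have "indiff pref (binary_lottery b w \<alpha>) (binary_lottery b w (u x))"
      using indiff_trans[OF C1 mem(2,3,1)] indiff_if_reduce_eq[OF R C1 mem(2,3) red] ind by blast
    then show ?thesis
      using C2 u \<alpha> by (auto simp: C2_def indiff_def intro: ge2_antisym)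
  qed
  \<comment> \<open>Weights 1 and 0 reduce to \<open>b\<close>, weights 0 and 1 to \<open>w\<close>.
    If \<open>b = w\<close>, both values arise and uniqueness forces 0 = 1.\<close>
  have "u b = (1, 0)" "u w = (0, 1)"
    by (intro unique ext; simp add: binary_scale_def reduce_binary_lottery)+
  moreover have "pref L L' \<longleftrightarrow> AEU u L \<ge>\<^sub>2 AEU u L'" if L: "L \<in> lotteries" and L': "L' \<in> lotteries"
    for L L'
  proof -
    note A = AEU_in_binary_scale[OF bua L] AEU_in_binary_scale[OF bua L']
    have "pref L L' \<longleftrightarrow> pref (binary_lottery b w (AEU u L)) (binary_lottery b w (AEU u L'))"
      using indiff_binary_lottery_AEU[OF R C1 C3 bua ind] L L' A
      by (intro pref_cong_indiff C1 binary_lottery_in_lotteries)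
    then show ?thesis
      using C2 A by (simp add: C2_def)
  qed
  ultimately show ?thesis
    using bua by blast
qed

lemma axioms_if_AEU_represents:
  assumes u: "basic_utility_assignment u" "u b = (1, 0)" "u w = (0, 1)"
    and rep: "\<And>L L'. L \<in> lotteries \<Longrightarrow> L' \<in> lotteries \<Longrightarrow> pref L L' \<longleftrightarrow> AEU u L \<ge>\<^sub>2 AEU u L'"
  shows "C1 pref" "C2 b w pref" "C3 pref" "C4 b w pref"
proof -
  \<comment> \<open>Antisymmetry of the order on pairs turns indifference into equality, so
    \<open>C3\<close> and \<open>C4\<close> become equations between expected utilities.\<close>
  have indiff_iff: "indiff pref L L' \<longleftrightarrow> AEU u L = AEU u L'"
    if "L \<in> lotteries" "L' \<in> lotteries" for L L'
    using that rep by (auto simp: indiff_def ge2_refl intro: ge2_antisym)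
  show "C1 pref"
    unfolding C1_def by (auto intro!: reflp_onI transp_onI simp: rep ge2_refl intro: ge2_trans)
  show "C2 b w pref"
    unfolding C2_def by (simp add: rep binary_lottery_in_lotteries AEU_binary_lottery[of u] u)
  show "C4 b w pref"
    unfolding C4_def
  proof
    fix x
    have "u x \<in> binary_scale"
      using u by (simp add: basic_utility_assignment_def)
    then show "\<exists>\<alpha>\<in>binary_scale. indiff pref (degenerate x) (binary_lottery b w \<alpha>)"
      \<comment> \<open>The witness is \<open>u x\<close> itself, the expected utility of both
        \<open>x\<close> and the binary lottery on \<open>u x\<close>.\<close>
      by (intro bexI[of _ "u x"]) (simp_all add: indiff_iff binary_lottery_in_lotteries
          degenerate_in_lotteries AEU_degenerate AEU_binary_lottery[of u] u)
  qed
  show "C3 pref"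
    unfolding C3_def
  proof (intro allI impI)
    fix k :: nat and L L' :: "nat \<Rightarrow> ('a, 'b) lottery" and l :: "nat \<Rightarrow> 'b"
    assume k: "k \<ge> 1" and l: "(\<Sum>i<k. l i) = 1"
      and L: "\<forall>i<k. L i \<in> lotteries \<and> L' i \<in> lotteries \<and> indiff pref (L i) (L' i)"
    \<comment> \<open>The representation speaks only about members of \<open>lotteries\<close>;
      \<open>k \<ge> 1\<close> makes the list of outcomes nonempty.\<close>
    have mem: "Compound (map (\<lambda>i. (l i, M i)) [0..<k]) \<in> lotteries"
      if "\<forall>i<k. M i \<in> lotteries" for M :: "nat \<Rightarrow> ('a, 'b) lottery"
      using that k l
      by (intro lotteries.compound)
        (auto simp: comp_def interv_sum_list_conv_sum_set_nat atLeast0LessThan)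
    have "AEU u (L i) = AEU u (L' i)" if "i < k" for i
      using L that indiff_iff by blast
    then have "AEU u (Compound (map (\<lambda>i. (l i, L i)) [0..<k])) =
        AEU u (Compound (map (\<lambda>i. (l i, L' i)) [0..<k]))"
      \<comment> \<open>Expected utility of a compound depends on its outcomes only through their
        expected utilities, which agree termwise.\<close>
      by (auto simp: AEU_Compound comp_def intro!: arg_cong[of _ _ sum_list])
    then show "indiff pref (Compound (map (\<lambda>i. (l i, L i)) [0..<k]))
        (Compound (map (\<lambda>i. (l i, L' i)) [0..<k]))"
      using L by (simp add: indiff_iff mem)
  qed
qed

theorem theorem1:
  fixes pref :: "('x::finite, 'p::semiring_scale) lottery \<Rightarrow> ('x, 'p) lottery \<Rightarrow> bool"
    and best worst :: 'x
  assumes R: "reduction_of_lotteries pref"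
    and best: "\<And>x. pref (degenerate best) (degenerate x)"
    and worst: "\<And>x. pref (degenerate x) (degenerate worst)"
  shows "(C1 pref \<and> C2 best worst pref \<and> C3 pref \<and> C4 best worst pref) \<longleftrightarrow>
    (\<exists>u. basic_utility_assignment u \<and> u best = (1, 0) \<and> u worst = (0, 1) \<and>
      (\<forall>L\<in>lotteries. \<forall>L'\<in>lotteries. pref L L' \<longleftrightarrow> AEU u L \<ge>\<^sub>2 AEU u L'))"
proof
  assume "C1 pref \<and> C2 best worst pref \<and> C3 pref \<and> C4 best worst pref"
  then show "\<exists>u. basic_utility_assignment u \<and> u best = (1, 0) \<and> u worst = (0, 1) \<and>
      (\<forall>L\<in>lotteries. \<forall>L'\<in>lotteries. pref L L' \<longleftrightarrow> AEU u L \<ge>\<^sub>2 AEU u L')"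
    by (elim conjE) (rule AEU_represents[OF R])
next
  assume "\<exists>u. basic_utility_assignment u \<and> u best = (1, 0) \<and> u worst = (0, 1) \<and>
      (\<forall>L\<in>lotteries. \<forall>L'\<in>lotteries. pref L L' \<longleftrightarrow> AEU u L \<ge>\<^sub>2 AEU u L')"
  then obtain u where "basic_utility_assignment u" "u best = (1, 0)" "u worst = (0, 1)"
    and "\<And>L L'. L \<in> lotteries \<Longrightarrow> L' \<in> lotteries \<Longrightarrow> pref L L' \<longleftrightarrow> AEU u L \<ge>\<^sub>2 AEU u L'"
    by blast
  note axioms_if_AEU_represents[OF this]
  then show "C1 pref \<and> C2 best worst pref \<and> C3 pref \<and> C4 best worst pref"
    by blast
qed

end
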